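(* (1) For every formula of $\mathsf{MTL}+\mathsf{URat}$ there is a formula of $\mathsf{MTL}+\mathsf{Rat}$ satisfied by exactly the same timed words (at the same positions); i.e. $\mathsf{MTL}+\mathsf{URat}\subseteq\mathsf{MTL}+\mathsf{Rat}$ in expressive power. (2) Likewise $\mathsf{MTL}+\mathsf{UM}\subseteq\mathsf{MTL}+\mathsf{MC}$ in expressive power.
   Context: Let $\Sigma$ be a finite set of propositions. A finite timed word over $\Sigma$ is $\rho=(\sigma,\tau)$ with $\sigma_i$ nonempty subsets of $\Sigma$, $\tau_i\in\mathbb{R}_{\ge0}$, $\tau_1=0$, $\tau_i\le\tau_{i+1}$, $dom(\rho)=\{1,\dots,n\}$. Intervals have endpoints in $\mathbb{N}\cup\{\infty\}$. $\mathsf{MTL}$: $\varphi::=a\mid true\mid\varphi\wedge\varphi\mid\neg\varphi\mid\varphi\mathsf{U}_I\varphi$, where $\rho,i\models\varphi_1\mathsf{U}_I\varphi_2$ iff some $j>i$ has $\rho,j\models\varphi_2$, $\tau_j-\tau_i\in I$ and $\rho,k\models\varphi_1$ for all $i<k<j$. For a finite set $\mathsf{S}$ of formulas and a rational expression $\mathsf{re}$ over $\mathsf{S}$ (atoms from $\mathsf{S}$, concatenation, union, star): $\mathsf{Seg}(\mathsf{S},i,j)$ is the word over $2^{\mathsf{S}}$ listing, for $k=i+1,\dots,j-1$, the set $\{\psi\in\mathsf{S}:\rho,k\models\psi\}$; $\mathsf{TSeg}(\mathsf{S},I,i)$ is the same over the positions $k$ with $\tau_k-\tau_i\in I$; $u^{\mathsf{single}}$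 is the set of words obtained by choosing one element from each letter of $u$. $\rho,i\models\varphi_1\mathsf{URat}_{I,\mathsf{re}}\varphi_2$ iff some $j>i$ has $\rho,j\models\varphi_2$, $\tau_j-\tau_i\in I$, $\rho,k\models\varphi_1$ for $i<k<j$, and $[\mathsf{Seg}(\mathsf{S},i,j)]^{\mathsf{single}}\cap L(\mathsf{re})\ne\emptyset$; $\rho,i\models\mathsf{Rat}_I\mathsf{re}$ iff $[\mathsf{TSeg}(\mathsf{S},I,i)]^{\mathsf{single}}\cap L(\mathsf{re})\ne\emptyset$. $\rho,i\models\varphi_1\mathsf{UM}_{I,\#\psi=k\%n}\varphi_2$ iff some $j>i$ has $\tau_j-\tau_i\in I$, $\rho,j\models\varphi_2$, $\rho,l\models\varphi_1$ for $i<l<j$, and the number of $l$ with $i<l<j$, $\rho,l\models\psi$ is $\equiv k \pmod n$; $\rho,i\models\mathsf{MC}^{k\%n}_I\varphi$ iff the number of positions $l$ with $\tau_l-\tau_i\in I$ and $\rho,l\models\varphi$ is $\equiv k\pmod n$. $\mathsf{MTL}+op$ denotes $\mathsf{MTL}$ (with arbitrary intervals) extended with the modality $op$ only, allowing arbitrary nesting.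
   Formalization: In TSeg and MC the positions k with τ_k − τ_i ∈ I are taken only among k ≥ i; if earlier positions with the same time stamp counted too, both claims would fail on words with repeated time stamps. For strictly increasing time stamps nothing changes. *)

theory Defs
  imports Complex_Main "HOL-Number_Theory.Cong"
begin

text \<open>
  Positions are numbered from 0: the word \<open>(\<sigma>, \<tau>)\<close> with domain \<open>{1..n}\<close> is
  the list of the pairs \<open>(\<sigma>\<^sub>i, \<tau>\<^sub>i)\<close>, and position \<open>i\<close> of the list
  stands for position \<open>i + 1\<close> of the domain.
\<close>

type_synonym 'p tword = "('p set \<times> real) list"

definition timed_word :: "'p tword \<Rightarrow> bool" where
  "timed_word \<rho> \<longleftrightarrow>
     \<rho> \<noteq> [] \<and> snd (\<rho> ! 0) = 0 \<and> sorted (map snd \<rho>) \<and> (\<forall>i<length \<rho>. fst (\<rho> ! i) \<noteq> {})"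

datatype interval =
    ClosedI nat nat | RightOpenI nat nat | LeftOpenI nat nat | OpenI nat nat | ClosedInf nat | OpenInf nat

fun points :: "interval \<Rightarrow> real set" where
  "points (ClosedI l u) = {real l..real u}"
| "points (RightOpenI l u) = {real l..<real u}"
| "points (LeftOpenI l u) = {real l<..real u}"
| "points (OpenI l u) = {real l<..<real u}"
| "points (ClosedInf l) = {real l..}"
| "points (OpenInf l) = {real l<..}"

datatype (atoms: 'a) rexp =
    Atom 'a | Concat "'a rexp" "'a rexp" | Union "'a rexp" "'a rexp" | Star "'a rexp"

fun lang :: "'a rexp \<Rightarrow> 'a list set" where
  "lang (Atom a) = {[a]}"
| "lang (Concat r s) = {u @ v | u v. u \<in> lang r \<and> v \<in> lang s}"
| "lang (Union r s) = lang r \<union> lang s"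
| "lang (Star r) = concat ` lists (lang r)"

text \<open>
  One syntax for all modalities; the individual logics are carved out by \<open>MTL_plus\<close> below.
  \<open>UM \<phi> I \<psi> k n \<chi>\<close> is \<open>\<phi> UM\<^bsub>I, #\<psi> = k%n\<^esub> \<chi>\<close>, and \<open>MC I k n \<phi>\<close> is
  \<open>MC\<^sup>k\<^sup>%\<^sup>n\<^sub>I \<phi>\<close>.
\<close>

datatype 'p formula =
    Prop 'p
  | Tru
  | And "'p formula" "'p formula"
  | Neg "'p formula"
  | Until "'p formula" interval "'p formula"
  | URat "'p formula" interval "'p formula rexp" "'p formula"
  | Rat interval "'p formula rexp"
  | UM "'p formula" interval "'p formula" nat nat "'p formula"
  | MC interval nat nat "'p formula"

text \<open>
  In \<open>seg\<close>, \<open>tseg\<close> and \<open>window\<close> the argument \<open>P k \<psi>\<close> says that \<open>\<psi>\<close> holds at position \<open>k\<close>.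

  The logics are future logics, so the positions \<open>k\<close> with \<open>\<tau>\<^sub>k - \<tau>\<^sub>i \<in> I\<close> are taken among
  \<open>k \<ge> i\<close>.  The restriction matters only if \<open>0 \<in> I\<close> and positions before \<open>i\<close> carry the same
  time stamp as \<open>i\<close>; without it, \<open>Rat\<close> and \<open>MC\<close> could not tell positions with equal time
  stamps apart, and both expressiveness results would fail.
\<close>

definition window :: "'p tword \<Rightarrow> interval \<Rightarrow> nat \<Rightarrow> nat list" where
  "window \<rho> I i = filter (\<lambda>k. snd (\<rho> ! k) - snd (\<rho> ! i) \<in> points I) [i..<length \<rho>]"

definition seg :: "(nat \<Rightarrow> 'f \<Rightarrow> bool) \<Rightarrow> 'f set \<Rightarrow> nat \<Rightarrow> nat \<Rightarrow> 'f set list" where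
  "seg P S i j = map (\<lambda>k. {\<psi> \<in> S. P k \<psi>}) [Suc i..<j]"

definition tseg ::
  "'p tword \<Rightarrow> (nat \<Rightarrow> 'f \<Rightarrow> bool) \<Rightarrow> 'f set \<Rightarrow> interval \<Rightarrow> nat \<Rightarrow> 'f set list" where
  "tseg \<rho> P S I i = map (\<lambda>k. {\<psi> \<in> S. P k \<psi>}) (window \<rho> I i)"

lemma seg_cong [fundef_cong]:
  assumes "S = S'" "i = i'" "j = j'" "\<And>k \<psi>. \<psi> \<in> S' \<Longrightarrow> P k \<psi> = P' k \<psi>"
  shows "seg P S i j = seg P' S' i' j'"
proof -
  have "{\<psi> \<in> S'. P k \<psi>} = {\<psi> \<in> S'. P' k \<psi>}" for k
    using assms(4) by blast
  then show ?thesis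
    using assms(1-3) by (simp add: seg_def)
qed

lemma tseg_cong [fundef_cong]:
  assumes "\<rho> = \<rho>'" "S = S'" "I = I'" "i = i'" "\<And>k \<psi>. \<psi> \<in> S' \<Longrightarrow> P k \<psi> = P' k \<psi>"
  shows "tseg \<rho> P S I i = tseg \<rho>' P' S' I' i'"
proof -
  have "{\<psi> \<in> S'. P k \<psi>} = {\<psi> \<in> S'. P' k \<psi>}" for k
    using assms(5) by blast
  then show ?thesis
    using assms(1-4) by (simp add: tseg_def)
qed

lemma size_atoms: "x \<in> atoms re \<Longrightarrow> f x < size_rexp f re"
  by (induction re) auto

text \<open>
  \<open>listset u\<close> is \<open>u\<^sup>s\<^sup>i\<^sup>n\<^sup>g\<^sup>l\<^sup>e\<close>.  The finite set \<open>S\<close> of a rational modality is the set of atoms of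
  its expression; any larger set gives the same semantics (\<open>single_lang_superset\<close> below).
\<close>

function sat :: "'p tword \<Rightarrow> nat \<Rightarrow> 'p formula \<Rightarrow> bool" where
  "sat \<rho> i (Prop a) \<longleftrightarrow> a \<in> fst (\<rho> ! i)"
| "sat \<rho> i Tru \<longleftrightarrow> True"
| "sat \<rho> i (And \<phi> \<psi>) \<longleftrightarrow> sat \<rho> i \<phi> \<and> sat \<rho> i \<psi>"
| "sat \<rho> i (Neg \<phi>) \<longleftrightarrow> \<not> sat \<rho> i \<phi>"
| "sat \<rho> i (Until \<phi> I \<chi>) \<longleftrightarrow>
     (\<exists>j<length \<rho>. i < j \<and> sat \<rho> j \<chi> \<and> snd (\<rho> ! j) - snd (\<rho> ! i) \<in> points I \<and>
        (\<forall>k. i < k \<and> k < j \<longrightarrow> sat \<rho> k \<phi>))"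
| "sat \<rho> i (URat \<phi> I re \<chi>) \<longleftrightarrow>
     (\<exists>j<length \<rho>. i < j \<and> sat \<rho> j \<chi> \<and> snd (\<rho> ! j) - snd (\<rho> ! i) \<in> points I \<and>
        (\<forall>k. i < k \<and> k < j \<longrightarrow> sat \<rho> k \<phi>) \<and>
        listset (seg (\<lambda>k \<psi>. sat \<rho> k \<psi>) (atoms re) i j) \<inter> lang re \<noteq> {})"
| "sat \<rho> i (Rat I re) \<longleftrightarrow>
     listset (tseg \<rho> (\<lambda>k \<psi>. sat \<rho> k \<psi>) (atoms re) I i) \<inter> lang re \<noteq> {}"
| "sat \<rho> i (UM \<phi> I \<psi> k n \<chi>) \<longleftrightarrow>
     (\<exists>j<length \<rho>. i < j \<and> sat \<rho> j \<chi> \<and> snd (\<rho> ! j) - snd (\<rho> ! i) \<in> points I \<and>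
        (\<forall>l. i < l \<and> l < j \<longrightarrow> sat \<rho> l \<phi>) \<and>
        [card {l. i < l \<and> l < j \<and> sat \<rho> l \<psi>} = k] (mod n))"
| "sat \<rho> i (MC I k n \<phi>) \<longleftrightarrow>
     [card {l \<in> set (window \<rho> I i). sat \<rho> l \<phi>} = k] (mod n)"
  by pat_completeness auto
termination
  by (relation "measure (\<lambda>(\<rho>, i, \<phi>). size \<phi>)") (auto dest: size_atoms[where f = size])

datatype modality = URAT | RAT | UMOD | MCOUNT

inductive_set MTL_plus :: "modality \<Rightarrow> 'p formula set" for op :: modality where
  "Prop a \<in> MTL_plus op"
| "Tru \<in> MTL_plus op"
| "\<phi> \<in> MTL_plus op \<Longrightarrow> \<psi> \<in> MTL_plus op \<Longrightarrow> And \<phi> \<psi> \<in> MTL_plus op"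
| "\<phi> \<in> MTL_plus op \<Longrightarrow> Neg \<phi> \<in> MTL_plus op"
| "\<phi> \<in> MTL_plus op \<Longrightarrow> \<chi> \<in> MTL_plus op \<Longrightarrow> Until \<phi> I \<chi> \<in> MTL_plus op"
| "op = URAT \<Longrightarrow> \<phi> \<in> MTL_plus op \<Longrightarrow> \<chi> \<in> MTL_plus op \<Longrightarrow> \<forall>\<psi>\<in>atoms re. \<psi> \<in> MTL_plus op \<Longrightarrow>
     URat \<phi> I re \<chi> \<in> MTL_plus op"
| "op = RAT \<Longrightarrow> \<forall>\<psi>\<in>atoms re. \<psi> \<in> MTL_plus op \<Longrightarrow> Rat I re \<in> MTL_plus op"
| "op = UMOD \<Longrightarrow> 0 < n \<Longrightarrow> \<phi> \<in> MTL_plus op \<Longrightarrow> \<chi> \<in> MTL_plus op \<Longrightarrow> \<psi> \<in> MTL_plus op \<Longrightarrow>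
     UM \<phi> I \<psi> k n \<chi> \<in> MTL_plus op"
| "op = MCOUNT \<Longrightarrow> 0 < n \<Longrightarrow> \<phi> \<in> MTL_plus op \<Longrightarrow> MC I k n \<phi> \<in> MTL_plus op"

definition equivalent :: "'p formula \<Rightarrow> 'p formula \<Rightarrow> bool" where
  "equivalent \<phi> \<psi> \<longleftrightarrow>
     (\<forall>\<rho> i. timed_word \<rho> \<longrightarrow> i < length \<rho> \<longrightarrow> (sat \<rho> i \<phi> \<longleftrightarrow> sat \<rho> i \<psi>))"

lemma listset_iff: "w \<in> listset us \<longleftrightarrow> list_all2 (\<in>) w us"
  by (induction us arbitrary: w) (auto simp: set_Cons_def list_all2_Cons2)

lemma lang_atoms: "w \<in> lang re \<Longrightarrow> set w \<subseteq> atoms re"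
proof (induction re arbitrary: w)
  case (Star re)
  then show ?case by (fastforce simp: lists_eq_set)
qed fastforce+

lemma single_lang_superset:
  assumes "atoms re \<subseteq> S"
  shows "listset (map (\<lambda>k. {\<psi> \<in> S. P k \<psi>}) ks) \<inter> lang re =
    listset (map (\<lambda>k. {\<psi> \<in> atoms re. P k \<psi>}) ks) \<inter> lang re"
proof -
  have "w \<in> listset (map (\<lambda>k. {\<psi> \<in> S. P k \<psi>}) ks) \<longleftrightarrow>
      w \<in> listset (map (\<lambda>k. {\<psi> \<in> atoms re. P k \<psi>}) ks)" if "w \<in> lang re" for w
    using lang_atoms[OF that] assms
    by (auto simp: listset_iff list_all2_conv_all_nth subset_iff)
  then show ?thesis by blast
qed

text \<open>On words with strictly increasing time stamps the restriction in \<open>window\<close> is vacuous.\<close>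

lemma set_window_strict:
  assumes "sorted_wrt (<) (map snd \<rho>)" "i < length \<rho>"
  shows "set (window \<rho> I i) = {k. k < length \<rho> \<and> snd (\<rho> ! k) - snd (\<rho> ! i) \<in> points I}"
proof -
  have nonneg: "0 \<le> x" if "x \<in> points I" for x
    using that by (cases I) auto
  have "i \<le> k" if "k < length \<rho>" "snd (\<rho> ! k) - snd (\<rho> ! i) \<in> points I" for k
  proof (rule ccontr)
    assume "\<not> i \<le> k"
    then have "snd (\<rho> ! k) < snd (\<rho> ! i)"
      using sorted_wrt_nth_less[OF assms(1), of k i] assms(2) by simp
    with nonneg[OF that(2)] show False by simp
  qed
  then show ?thesis by (auto simp: window_def)
qed

end

theory Submission
  imports Defs
begin

text \<open>
  For \<open>UM\<close>, count to the end of the word: the number of \<open>\<psi>\<close>-positions strictly between \<open>i\<close> and \<open>j\<close>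
  is the number of those after \<open>i\<close> minus the number of those from \<open>j\<close> on, and modulo \<open>n\<close> both
  can be tested by \<open>MC\<close> over \<open>[0, \<infinity>)\<close>, the second one at the witness \<open>j\<close> of an \<open>Until\<close>.

  For \<open>URat\<close>, the witness \<open>j\<close> lies in the window of \<open>I\<close>, so the positions from \<open>i\<close> to \<open>j - 1\<close> are
  those of the window of the times preceding \<open>I\<close>, followed by an initial part of the window of \<open>I\<close>.
  A rational expression has only finitely many ways \<open>(p, q)\<close> of splitting its words, so a finite
  disjunction can test \<open>p\<close> on the first window and \<open>q \<cdot> \<chi> \<cdot> true\<^sup>*\<close> on the second.
\<close>

section \<open>Matching lists of positions against rational expressions\<close>

text \<open>Lists of positions replace words over \<open>2^S\<close>: choosing one true atom at each
  position becomes \<open>list_all2\<close>. The resulting sets obey the recursion of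
  \<open>lang\<close>, and the set of atoms drops out.\<close>

definition matches :: "('k \<Rightarrow> 'a \<Rightarrow> bool) \<Rightarrow> 'a rexp \<Rightarrow> 'k list set" where
  "matches P r = {ks. \<exists>w \<in> lang r. list_all2 P ks w}"

lemma matches_Atom: "matches P (Atom a) = {[k] | k. P k a}"
  by (auto simp: matches_def list_all2_Cons2)

lemma matches_Concat:
  "matches P (Concat r s) = {u @ v | u v. u \<in> matches P r \<and> v \<in> matches P s}"
proof -
  have "ks \<in> matches P (Concat r s) \<longleftrightarrow> (\<exists>w w'. w \<in> lang r \<and> w' \<in> lang s \<and> list_all2 P ks (w @ w'))" for ks
    by (auto simp: matches_def)
  also have "\<dots> ks \<longleftrightarrow> (\<exists>u v. ks = u @ v \<and> u \<in> matches P r \<and> v \<in> matches P s)" for ks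
    unfolding list_all2_append2 matches_def mem_Collect_eq
    by (metis list_all2_lengthD)
  finally show ?thesis by blast
qed

lemma matches_Concat_Atom: "matches P (Concat (Atom a) r) = {k # ks | k ks. P k a \<and> ks \<in> matches P r}"
  unfolding matches_Concat matches_Atom by auto (metis append_Cons append_Nil)

lemma matches_Union: "matches P (Union r s) = matches P r \<union> matches P s"
  by (auto simp: matches_def)

lemma list_all2_concat2:
  "list_all2 P ks (concat ws) \<longleftrightarrow> (\<exists>kss. ks = concat kss \<and> list_all2 (list_all2 P) kss ws)"
proof (induction ws arbitrary: ks)
  case (Cons w ws)
  show ?case
  proof
    assume "list_all2 P ks (concat (w # ws))"
    then obtain u v where "ks = u @ v" "list_all2 P u w" "list_all2 P v (concat ws)"
      by (auto simp: list_all2_append2)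
    moreover from this(3) obtain kss where "v = concat kss" "list_all2 (list_all2 P) kss ws"
      using Cons.IH by auto
    ultimately show "\<exists>kss. ks = concat kss \<and> list_all2 (list_all2 P) kss (w # ws)"
      by (intro exI[of _ "u # kss"]) auto
  next
    assume "\<exists>kss. ks = concat kss \<and> list_all2 (list_all2 P) kss (w # ws)"
    then show "list_all2 P ks (concat (w # ws))"
      by (force simp: Cons.IH list_all2_Cons2 intro!: list_all2_appendI)
  qed
qed auto

lemma matches_Star: "matches P (Star r) = concat ` lists (matches P r)"
proof -
  \<comment> \<open>Words for the blocks can be chosen independently of one another.\<close>
  have "(\<exists>ws \<in> lists (lang r). list_all2 (list_all2 P) kss ws) \<longleftrightarrow> kss \<in> lists (matches P r)" for kss
  proof (induction kss)
    case (Cons ks kss)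
    have "(\<exists>ws \<in> lists (lang r). list_all2 (list_all2 P) (ks # kss) ws) \<longleftrightarrow>
        (\<exists>w \<in> lang r. list_all2 P ks w) \<and> (\<exists>ws \<in> lists (lang r). list_all2 (list_all2 P) kss ws)"
      unfolding list_all2_Cons1 by (metis Cons_in_lists_iff)
    with Cons.IH show ?case
      by (simp add: matches_def)
  qed auto
  then have "ks \<in> matches P (Star r) \<longleftrightarrow> (\<exists>kss \<in> lists (matches P r). ks = concat kss)" for ks
    by (simp add: matches_def list_all2_concat2) blast
  then show ?thesis by blast
qed

lemma matches_StarI:
  shows Nil_in_matches_Star: "[] \<in> matches P (Star r)"
    and append_in_matches_Star:
      "u \<in> matches P r \<Longrightarrow> v \<in> matches P (Star r) \<Longrightarrow> u @ v \<in> matches P (Star r)"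
    and append_in_matches_Star2:
      "u \<in> matches P (Star r) \<Longrightarrow> v \<in> matches P (Star r) \<Longrightarrow> u @ v \<in> matches P (Star r)"
proof -
  show "[] \<in> matches P (Star r)"
    unfolding matches_Star by (rule image_eqI[of _ _ "[]"]) auto
  show "u @ v \<in> matches P (Star r)" if "u \<in> matches P r" "v \<in> matches P (Star r)"
  proof -
    from that(2) obtain vs where "v = concat vs" "vs \<in> lists (matches P r)"
      unfolding matches_Star by auto
    with that(1) show ?thesis
      unfolding matches_Star by (intro image_eqI[of _ _ "u # vs"]) auto
  qed
  show "u @ v \<in> matches P (Star r)" if "u \<in> matches P (Star r)" "v \<in> matches P (Star r)"
  proof -
    from that obtain us vs where "u = concat us" "us \<in> lists (matches P r)"
      "v = concat vs" "vs \<in> lists (matches P r)"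
      unfolding matches_Star by auto
    then show ?thesis
      unfolding matches_Star by (intro image_eqI[of _ _ "us @ vs"]) auto
  qed
qed

lemma matches_Star_True:
  assumes "\<And>k. P k a"
  shows "matches P (Star (Atom a)) = UNIV"
proof -
  have "ks \<in> matches P (Star (Atom a))" for ks
  proof (induction ks)
    case (Cons k ks)
    then have "[k] @ ks \<in> matches P (Star (Atom a))"
      by (intro append_in_matches_Star) (auto simp: matches_Atom assms)
    then show ?case by simp
  qed (rule Nil_in_matches_Star)
  then show ?thesis by blast
qed

text \<open>An atom that holds nowhere can never be chosen, so only zero iterations match: this
  realizes the empty word inside the logic.\<close>

lemma matches_Star_False:
  assumes "\<And>k. \<not> P k a"
  shows "matches P (Star (Atom a)) = {[]}"
proof -
  have "matches P (Atom a) = {}"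
    using assms by (simp add: matches_Atom)
  then show ?thesis
    by (simp add: matches_Star)
qed

lemma matches_map_rexp: "matches P (map_rexp f r) = matches (\<lambda>k a. P k (f a)) r"
  by (induction r) (simp_all add: matches_Atom matches_Concat matches_Union matches_Star)

text \<open>A matched list and its word have equal length, so a condition conjoined to every atom is
  tested at each position. The left argument of \<open>URat\<close> enters the expression in this
  way.\<close>

lemma matches_conj:
  "ks \<in> matches (\<lambda>k a. Q k \<and> P k a) r \<longleftrightarrow> ks \<in> matches P r \<and> (\<forall>k \<in> set ks. Q k)"
proof -
  have "list_all2 (\<lambda>k a. Q k \<and> P k a) ks w \<longleftrightarrow> list_all2 P ks w \<and> (\<forall>k \<in> set ks. Q k)" for w
    by (induction ks arbitrary: w) (auto simp: list_all2_Cons1)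
  then show ?thesis
    by (auto simp: matches_def)
qed

text \<open>The restriction to \<open>set ks\<close> matters later: a formula and its translation
  are known to agree only at positions of the word.\<close>

lemma matches_cong:
  assumes "\<And>k a. k \<in> set ks \<Longrightarrow> a \<in> atoms r \<Longrightarrow> P k a \<longleftrightarrow> Q k a"
  shows "ks \<in> matches P r \<longleftrightarrow> ks \<in> matches Q r"
proof -
  have "list_all2 P ks w \<longleftrightarrow> list_all2 Q ks w" if "w \<in> lang r" for w
    using lang_atoms[OF that] assms
    by (auto simp: list_all2_conv_all_nth subset_iff)
  then show ?thesis
    by (auto simp: matches_def)
qed

lemma listset_Int_lang_iff_matches:
  "listset (map (\<lambda>k. {a \<in> atoms r. P k a}) ks) \<inter> lang r \<noteq> {} \<longleftrightarrow> ks \<in> matches P r"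
proof -
  have "w \<in> listset (map (\<lambda>k. {a \<in> atoms r. P k a}) ks) \<longleftrightarrow> list_all2 P ks w" if "w \<in> lang r" for w
    using lang_atoms[OF that]
    by (auto simp: listset_iff list_all2_conv_all_nth subset_iff)
  then show ?thesis
    by (auto simp: matches_def)
qed

section \<open>Splitting rational expressions\<close>

text \<open>
  The argument \<open>e\<close> stands for the empty word, which has no expression of its own: every expression
  without \<open>Star\<close> has nonempty words only, and \<open>lang (Star r)\<close> is never \<open>{[]}\<close>.
\<close>

primrec splits :: "'a rexp \<Rightarrow> 'a rexp \<Rightarrow> ('a rexp \<times> 'a rexp) list" where
  "splits e (Atom a) = [(e, Atom a), (Atom a, e)]"
| "splits e (Concat r s) =
     map (\<lambda>(p, q). (p, Concat q s)) (splits e r) @ map (\<lambda>(p, q). (Concat r p, q)) (splits e s)"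
| "splits e (Union r s) = splits e r @ splits e s"
| "splits e (Star r) =
     (e, e) # map (\<lambda>(p, q). (Concat (Star r) p, Concat q (Star r))) (splits e r)"

text \<open>Keeps the translation within its fragment.\<close>

lemma atoms_splits:
  "(p, q) \<in> set (splits e r) \<Longrightarrow> atoms p \<subseteq> atoms e \<union> atoms r \<and> atoms q \<subseteq> atoms e \<union> atoms r"
  by (induction r arbitrary: p q) fastforce+

lemma splits_sound:
  assumes "matches P e = {[]}"
  shows "(p, q) \<in> set (splits e r) \<Longrightarrow> u \<in> matches P p \<Longrightarrow> v \<in> matches P q \<Longrightarrow> u @ v \<in> matches P r"
proof (induction r arbitrary: p q u v)
  case (Atom a)
  then show ?case by (auto simp: assms)
next
  case (Concat r s)
  from Concat.prems(1) consider
      q' where "(p, q') \<in> set (splits e r)" "q = Concat q' s"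
    | p' where "(p', q) \<in> set (splits e s)" "p = Concat r p'"
    by auto
  then show ?case
  proof cases
    case 1
    with Concat.prems obtain v1 v2 where "v = v1 @ v2" "v1 \<in> matches P q'" "v2 \<in> matches P s"
      by (auto simp: matches_Concat)
    with 1 Concat.IH(1)[of p q' u v1] Concat.prems(2) show ?thesis
      unfolding matches_Concat by (metis (mono_tags, lifting) append.assoc mem_Collect_eq)
  next
    case 2
    with Concat.prems obtain u1 u2 where "u = u1 @ u2" "u1 \<in> matches P r" "u2 \<in> matches P p'"
      by (auto simp: matches_Concat)
    with 2 Concat.IH(2)[of p' q u2 v] Concat.prems(3) show ?thesis
      unfolding matches_Concat by (metis (mono_tags, lifting) append.assoc mem_Collect_eq)
  qed
next
  case (Union r s)
  then show ?case by (auto simp: matches_Union)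
next
  case (Star r)
  from Star.prems(1) consider
      "p = e" "q = e"
    | p' q' where "(p', q') \<in> set (splits e r)" "p = Concat (Star r) p'" "q = Concat q' (Star r)"
    by auto
  then show ?case
  proof cases
    case 1
    with Star.prems show ?thesis
      by (simp add: assms Nil_in_matches_Star)
  next
    case 2
    with Star.prems obtain u1 u2 v1 v2 where uv: "u = u1 @ u2" "v = v1 @ v2"
      "u1 \<in> matches P (Star r)" "u2 \<in> matches P p'" "v1 \<in> matches P q'" "v2 \<in> matches P (Star r)"
      by (auto simp: matches_Concat)
    \<comment> \<open>The cut lies inside one iteration: \<open>u2 @ v1\<close> is that iteration
      put together again, between the complete iterations in \<open>u1\<close> and
      \<open>v2\<close>.\<close>
    with Star.IH[OF 2(1)] have "u1 @ (u2 @ v1) @ v2 \<in> matches P (Star r)"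
      by (intro append_in_matches_Star append_in_matches_Star2)
    with uv show ?thesis by simp
  qed
qed

text \<open>A cut of the matched list falls into one of its pieces; following it down the expression
  yields the pair.\<close>

lemma splits_complete:
  assumes "matches P e = {[]}"
  shows "u @ v \<in> matches P r \<Longrightarrow> \<exists>(p, q) \<in> set (splits e r). u \<in> matches P p \<and> v \<in> matches P q"
proof (induction r arbitrary: u v)
  case (Atom a)
  then show ?case by (auto simp: matches_Atom assms append_eq_Cons_conv)
next
  case (Concat r s)
  then obtain x y where xy: "u @ v = x @ y" "x \<in> matches P r" "y \<in> matches P s"
    by (auto simp: matches_Concat)
  from xy(1) consider
      z where "u = x @ z" "z @ v = y" | z where "u @ z = x" "v = z @ y"
    by (auto simp: append_eq_append_conv2)
  then show ?case
  proof cases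
    case 1
    with xy Concat.IH(2) obtain p q where
      "(p, q) \<in> set (splits e s)" "z \<in> matches P p" "v \<in> matches P q"
      by blast
    with xy 1 show ?thesis
      by (intro bexI[of _ "(Concat r p, q)"]) (force simp: matches_Concat)+
  next
    case 2
    with xy Concat.IH(1) obtain p q where
      "(p, q) \<in> set (splits e r)" "u \<in> matches P p" "z \<in> matches P q"
      by blast
    with xy 2 show ?thesis
      by (intro bexI[of _ "(p, Concat q s)"]) (force simp: matches_Concat)+
  qed
next
  case (Union r s)
  then show ?case by (fastforce simp: matches_Union)
next
  case (Star r)
  \<comment> \<open>The first alternative is the pair \<open>(e, e)\<close>, which serves only the
    cut of the empty list; every other cut is charged to an iteration.\<close>
  let ?split = "\<lambda>u v. u = [] \<and> v = [] \<or> (\<exists>(p, q) \<in> set (splits e r).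
    u \<in> matches P (Concat (Star r) p) \<and> v \<in> matches P (Concat q (Star r)))"
  have split1: "?split u (v @ y)" if "u @ v \<in> matches P r" "y \<in> matches P (Star r)" for u v y
  proof -
    from Star.IH[OF that(1)] obtain p q where
      pq: "(p, q) \<in> set (splits e r)" "u \<in> matches P p" "v \<in> matches P q"
      by blast
    \<comment> \<open>No iteration precedes the cut, so the leading star matches
      \<open>[]\<close>.\<close>
    then have "[] @ u \<in> matches P (Concat (Star r) p)" "v @ y \<in> matches P (Concat q (Star r))"
      unfolding matches_Concat using that(2) Nil_in_matches_Star by blast+
    with pq(1) show ?thesis by auto
  qed
  have "?split u v" if "ws \<in> lists (matches P r)" "concat ws = u @ v" for ws
    using that
  proof (induction ws arbitrary: u rule: list.induct)
    case (Cons w ws)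
    from Cons.prems have w: "w \<in> matches P r" and ws: "ws \<in> lists (matches P r)"
      and eq: "w @ concat ws = u @ v"
      by auto
    from eq consider
        z where "u @ z = w" "v = z @ concat ws" | z where "u = w @ z" "concat ws = z @ v"
      by (auto simp: append_eq_append_conv2)
    then show ?case
    proof cases
      case 1
      with split1[of u z "concat ws"] w ws show ?thesis
        by (simp add: matches_Star)
    next
      case 2
      from Cons.IH[OF ws 2(2)] show ?thesis
      proof
        assume "z = [] \<and> v = []"
        \<comment> \<open>The cut falls at the end of \<open>w\<close> and nothing follows it:
          \<open>w\<close> is split as \<open>u @ []\<close>.\<close>
        with 2 split1[of u "[]" "[]"] w show ?thesis
          by (simp add: Nil_in_matches_Star)
      next
        assume "\<exists>(p, q) \<in> set (splits e r).
          z \<in> matches P (Concat (Star r) p) \<and> v \<in> matches P (Concat q (Star r))"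
        then obtain p q z1 z2 where "(p, q) \<in> set (splits e r)" "z = z1 @ z2"
          "z1 \<in> matches P (Star r)" "z2 \<in> matches P p" "v \<in> matches P (Concat q (Star r))"
          by (auto simp: matches_Concat[of P "Star r"])
        \<comment> \<open>\<open>w\<close> joins the complete iterations before the cut.\<close>
        moreover from this w have "(w @ z1) @ z2 \<in> matches P (Concat (Star r) p)"
          unfolding matches_Concat[of P "Star r" p] using append_in_matches_Star by blast
        ultimately show ?thesis
          using 2(1) by auto
      qed
    qed
  qed simp
  moreover from Star.prems obtain ws where "ws \<in> lists (matches P r)" "concat ws = u @ v"
    unfolding matches_Star by (metis imageE)
  ultimately have "?split u v" by blast
  then show ?case
    by (auto simp: assms)
qed

lemma append_in_matches_iff_splits:
  assumes "matches P e = {[]}"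
  shows "u @ v \<in> matches P r \<longleftrightarrow> (\<exists>(p, q) \<in> set (splits e r). u \<in> matches P p \<and> v \<in> matches P q)"
  using splits_sound[OF assms] splits_complete[OF assms] by blast

section \<open>Windows of timed words\<close>

lemma timed_word_mono:
  assumes "timed_word \<rho>" "i \<le> j" "j < length \<rho>"
  shows "snd (\<rho> ! i) \<le> snd (\<rho> ! j)"
  using assms sorted_nth_mono[of "map snd \<rho>" i j] by (simp add: timed_word_def)

lemma set_window_ClosedInf_0:
  assumes "timed_word \<rho>"
  shows "set (window \<rho> (ClosedInf 0) i) = {i..<length \<rho>}"
  using timed_word_mono[OF assms] by (auto simp: window_def)

text \<open>For a closed left endpoint \<open>0\<close> the result \<open>RightOpenI 0 0\<close> has
  no points, so the first window is then empty.\<close>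

fun before :: "interval \<Rightarrow> interval" where
  "before (ClosedI l u) = RightOpenI 0 l"
| "before (RightOpenI l u) = RightOpenI 0 l"
| "before (LeftOpenI l u) = ClosedI 0 l"
| "before (OpenI l u) = ClosedI 0 l"
| "before (ClosedInf l) = RightOpenI 0 l"
| "before (OpenInf l) = ClosedI 0 l"

lemma before_less: "x \<in> points (before I) \<Longrightarrow> y \<in> points I \<Longrightarrow> x < y"
  by (cases I) auto

text \<open>Intervals are convex: \<open>y\<close> supplies the upper bound, so \<open>x\<close> can
  miss \<open>I\<close> only on the left.\<close>

lemma in_points_or_before:
  "0 \<le> x \<Longrightarrow> x \<le> y \<Longrightarrow> y \<in> points I \<Longrightarrow> x \<in> points I \<or> x \<in> points (before I)"
  by (cases I) auto

text \<open>The order condition makes \<open>Q\<close> hold on an initial segment, so the two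
  filtered parts are a prefix and the remaining suffix.\<close>

lemma filter_append_filter_not:
  "sorted_wrt (\<lambda>x y. Q y \<longrightarrow> Q x) xs \<Longrightarrow> filter Q xs @ filter (\<lambda>x. \<not> Q x) xs = xs"
  by (induction xs) (auto simp: filter_empty_conv filter_id_conv)

text \<open>Delays never decrease along the word, so those from \<open>i\<close> to
  \<open>j - 1\<close> do not exceed the delay of \<open>j\<close>, which is in \<open>I\<close>.
  They lie in \<open>before I\<close> up to some position and in \<open>I\<close> from there on;
  \<open>ks\<close> is this second portion.\<close>

lemma window_split:
  assumes "timed_word \<rho>" "i \<le> j" "j < length \<rho>" "snd (\<rho> ! j) - snd (\<rho> ! i) \<in> points I"
  obtains ks ls where
    "window \<rho> (before I) i @ ks = [i..<j]" "window \<rho> I i = ks @ j # ls"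
proof
  define t where "t k = snd (\<rho> ! k) - snd (\<rho> ! i)" for k
  let ?B = "\<lambda>k. t k \<in> points (before I)"
  let ?I = "\<lambda>k. t k \<in> points I"
  note mono = timed_word_mono[OF assms(1)]
  have j: "?I j" using assms(4) by (simp add: t_def)
  have upt: "[i..<length \<rho>] = [i..<j] @ j # [Suc j..<length \<rho>]"
    using assms(2,3) by (metis le_add_diff_inverse less_imp_le upt_add_eq_append upt_conv_Cons)
  have "\<not> ?B k" if "j \<le> k" "k < length \<rho>" for k
    using before_less[of "t k" I "t j"] j mono[OF that] by (auto simp: t_def)
  then have before: "window \<rho> (before I) i = filter ?B [i..<j]"
    using assms(3) by (auto simp: window_def upt t_def[symmetric] filter_empty_conv)
  have I_iff: "?I k \<longleftrightarrow> \<not> ?B k" if "k \<in> {i..<j}" for k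
    using in_points_or_before[of "t k" "t j" I] before_less[of "t k" I "t k"] j
      mono[of i k] mono[of k j] that assms(3) by (auto simp: t_def)
  \<comment> \<open>Otherwise the delay of \<open>k\<close> would be in \<open>I\<close> and so
    exceed that of \<open>l\<close>, although \<open>k \<le> l\<close>.\<close>
  have down: "?B k" if "?B l" "i \<le> k" "k \<le> l" "l < j" for k l
    using I_iff[of k] before_less[OF that(1), of "t k"] mono[of k l] that assms(3)
    by (auto simp: t_def)
  have "sorted_wrt (\<lambda>k l. ?B l \<longrightarrow> ?B k) [i..<j]"
    by (rule sorted_wrt_mono_rel[OF _ sorted_wrt_upt]) (use down in auto)
  from filter_append_filter_not[OF this]
  show "window \<rho> (before I) i @ filter ?I [i..<j] = [i..<j]"
    using I_iff before by (metis (no_types, lifting) atLeastLessThan_upt filter_cong)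
  show "window \<rho> I i = filter ?I [i..<j] @ j # filter ?I [Suc j..<length \<rho>]"
    using j by (simp add: window_def upt t_def[symmetric])
qed

section \<open>Finite disjunctions\<close>

definition disjunction :: "'p formula list \<Rightarrow> 'p formula" where
  "disjunction \<phi>s = Neg (foldr And (map Neg \<phi>s) Tru)"

lemma sat_disjunction: "sat \<rho> i (disjunction \<phi>s) \<longleftrightarrow> (\<exists>\<phi> \<in> set \<phi>s. sat \<rho> i \<phi>)"
proof -
  have "sat \<rho> i (foldr And (map Neg \<phi>s) Tru) \<longleftrightarrow> (\<forall>\<phi> \<in> set \<phi>s. \<not> sat \<rho> i \<phi>)"
    by (induction \<phi>s) auto
  then show ?thesis by (simp add: disjunction_def)
qed

lemma disjunction_in_MTL_plus:
  assumes "\<And>\<phi>. \<phi> \<in> set \<phi>s \<Longrightarrow> \<phi> \<in> MTL_plus op"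
  shows "disjunction \<phi>s \<in> MTL_plus op"
proof -
  have "foldr And (map Neg \<phi>s) Tru \<in> MTL_plus op"
    using assms by (induction \<phi>s) (auto intro: MTL_plus.intros)
  then show ?thesis
    unfolding disjunction_def by (rule MTL_plus.intros)
qed

section \<open>From \<open>URat\<close> to \<open>Rat\<close>\<close>

lemma sat_Rat: "sat \<rho> i (Rat I r) \<longleftrightarrow> window \<rho> I i \<in> matches (sat \<rho>) r"
  by (simp only: sat.simps tseg_def listset_Int_lang_iff_matches)

lemma sat_URat:
  "sat \<rho> i (URat \<phi> I r \<chi>) \<longleftrightarrow>
    (\<exists>j<length \<rho>. i < j \<and> sat \<rho> j \<chi> \<and> snd (\<rho> ! j) - snd (\<rho> ! i) \<in> points I \<and>
      (\<forall>k \<in> {i<..<j}. sat \<rho> k \<phi>) \<and> [Suc i..<j] \<in> matches (sat \<rho>) r)"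
  by (simp only: sat.simps seg_def listset_Int_lang_iff_matches Ball_def greaterThanLessThan_iff)

definition eps :: "'p formula rexp" where
  "eps = Star (Atom (Neg Tru))"

lemma matches_eps: "matches (sat \<rho>) eps = {[]}"
  unfolding eps_def by (rule matches_Star_False) simp

text \<open>
  The leading \<open>Atom Tru\<close> reads position \<open>i\<close>, which lies in the window of \<open>before I\<close> or of \<open>I\<close>
  but not in \<open>seg\<close>. Splitting the prefixed expression covers both cases at once, and forces \<open>i < j\<close>.
\<close>

definition urat_rat :: "'p formula \<Rightarrow> interval \<Rightarrow> 'p formula rexp \<Rightarrow> 'p formula \<Rightarrow> 'p formula" where
  "urat_rat \<phi> I r \<chi> =
    disjunction (map (\<lambda>(p, q). And (Rat (before I) p) (Rat I (Concat q (Concat (Atom \<chi>) (Star (Atom Tru))))))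
      (splits eps (Concat (Atom Tru) (map_rexp (And \<phi>) r))))"

text \<open>\<open>And \<phi>\<close> is applied to the atoms of \<open>r\<close> but not to the
  leading \<open>Tru\<close>, so \<open>\<phi>\<close> is tested strictly between \<open>i\<close>
  and \<open>j\<close>. For \<open>j \<le> i\<close> the list is empty and the leading atom has
  nothing to read.\<close>

lemma matches_prefixed:
  "[i..<j] \<in> matches (sat \<rho>) (Concat (Atom Tru) (map_rexp (And \<phi>) r)) \<longleftrightarrow>
    i < j \<and> (\<forall>k \<in> {i<..<j}. sat \<rho> k \<phi>) \<and> [Suc i..<j] \<in> matches (sat \<rho>) r"
proof -
  have "[i..<j] \<in> matches (sat \<rho>) (Concat (Atom Tru) (map_rexp (And \<phi>) r)) \<longleftrightarrow>
      i < j \<and> [Suc i..<j] \<in> matches (sat \<rho>) (map_rexp (And \<phi>) r)"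
    by (cases "i < j") (auto simp: matches_Concat_Atom upt_conv_Cons)
  also have "\<dots> \<longleftrightarrow> i < j \<and> (\<forall>k \<in> {i<..<j}. sat \<rho> k \<phi>) \<and> [Suc i..<j] \<in> matches (sat \<rho>) r"
    by (auto simp: matches_map_rexp matches_conj)
  finally show ?thesis .
qed

text \<open>\<open>Atom \<chi>\<close> guesses the witness \<open>j\<close> in the window, and the
  starred \<open>Tru\<close> absorbs the rest.\<close>

lemma matches_suffixed:
  "ks \<in> matches (sat \<rho>) (Concat q (Concat (Atom \<chi>) (Star (Atom Tru)))) \<longleftrightarrow>
    (\<exists>u j v. ks = u @ j # v \<and> u \<in> matches (sat \<rho>) q \<and> sat \<rho> j \<chi>)"
  unfolding matches_Concat[of _ q] by (auto simp: matches_Concat_Atom matches_Star_True)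

lemma sat_urat_rat:
  assumes "timed_word \<rho>" "i < length \<rho>"
  shows "sat \<rho> i (urat_rat \<phi> I r \<chi>) \<longleftrightarrow> sat \<rho> i (URat \<phi> I r \<chi>)"
proof -
  let ?R = "Concat (Atom Tru) (map_rexp (And \<phi>) r)"
  have "sat \<rho> i (urat_rat \<phi> I r \<chi>) \<longleftrightarrow>
      (\<exists>u j v. window \<rho> I i = u @ j # v \<and> sat \<rho> j \<chi> \<and>
        (\<exists>(p, q) \<in> set (splits eps ?R). window \<rho> (before I) i \<in> matches (sat \<rho>) p \<and> u \<in> matches (sat \<rho>) q))"
    by (simp add: urat_rat_def sat_disjunction sat_Rat matches_suffixed case_prod_unfold
        del: splits.simps sat.simps(7)) blast
  \<comment> \<open>Both windows are tested with the same pair, so the disjunction over all pairs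
    says that their concatenation matches the unsplit expression.\<close>
  also have "\<dots> \<longleftrightarrow> (\<exists>u j v. window \<rho> I i = u @ j # v \<and> sat \<rho> j \<chi> \<and>
      window \<rho> (before I) i @ u \<in> matches (sat \<rho>) ?R)"
    by (simp only: append_in_matches_iff_splits[OF matches_eps])
  \<comment> \<open>Only \<open>i \<le> j\<close> at this stage, since the window may contain
    \<open>i\<close>; the matching itself excludes \<open>j = i\<close>.\<close>
  also have "\<dots> \<longleftrightarrow> (\<exists>j<length \<rho>. i \<le> j \<and> sat \<rho> j \<chi> \<and> snd (\<rho> ! j) - snd (\<rho> ! i) \<in> points I \<and>
      [i..<j] \<in> matches (sat \<rho>) ?R)"
  proof (intro iffI; elim exE conjE)
    fix u j v
    assume u: "window \<rho> I i = u @ j # v" "sat \<rho> j \<chi>" "window \<rho> (before I) i @ u \<in> matches (sat \<rho>) ?R"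
    have "j \<in> set (window \<rho> I i)" using u(1) by simp
    then have j: "i \<le> j" "j < length \<rho>" "snd (\<rho> ! j) - snd (\<rho> ! i) \<in> points I"
      by (auto simp: window_def)
    obtain ks ls where ks: "window \<rho> (before I) i @ ks = [i..<j]" "window \<rho> I i = ks @ j # ls"
      using window_split[OF assms(1) j] .
    \<comment> \<open>\<open>j\<close> occurs only once in the window, so its two decompositions
      around \<open>j\<close> coincide.\<close>
    have "distinct (window \<rho> I i)" by (simp add: window_def)
    with u(1) ks(2) have "j \<notin> set u" "j \<notin> set v" "u @ j # v = ks @ j # ls" by auto
    then have "u = ks" by (simp add: append_Cons_eq_iff)
    with u ks j show "\<exists>j<length \<rho>. i \<le> j \<and> sat \<rho> j \<chi> \<and> snd (\<rho> ! j) - snd (\<rho> ! i) \<in> points I \<and>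
        [i..<j] \<in> matches (sat \<rho>) ?R"
      by auto
  next
    fix j
    assume j: "j < length \<rho>" "i \<le> j" "snd (\<rho> ! j) - snd (\<rho> ! i) \<in> points I"
      and "sat \<rho> j \<chi>" "[i..<j] \<in> matches (sat \<rho>) ?R"
    moreover obtain ks ls where "window \<rho> (before I) i @ ks = [i..<j]" "window \<rho> I i = ks @ j # ls"
      using window_split[OF assms(1) j(2,1,3)] .
    ultimately show "\<exists>u j v. window \<rho> I i = u @ j # v \<and> sat \<rho> j \<chi> \<and>
        window \<rho> (before I) i @ u \<in> matches (sat \<rho>) ?R"
      by metis
  qed
  also have "\<dots> \<longleftrightarrow> sat \<rho> i (URat \<phi> I r \<chi>)"
    unfolding matches_prefixed sat_URat by (meson less_imp_le)
  finally show ?thesis .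
qed

lemma urat_rat_in_MTL_plus:
  assumes "\<phi> \<in> MTL_plus RAT" "\<chi> \<in> MTL_plus RAT" "\<forall>\<psi> \<in> atoms r. \<psi> \<in> MTL_plus RAT"
  shows "urat_rat \<phi> I r \<chi> \<in> MTL_plus RAT"
proof -
  let ?R = "Concat (Atom Tru) (map_rexp (And \<phi>) r)"
  have "\<psi> \<in> MTL_plus RAT" if "\<psi> \<in> atoms eps \<union> atoms ?R" for \<psi>
    using that assms by (auto simp: eps_def rexp.set_map intro: MTL_plus.intros)
  then have "\<psi> \<in> MTL_plus RAT" if "(p, q) \<in> set (splits eps ?R)" "\<psi> \<in> atoms p \<union> atoms q" for p q \<psi>
    using atoms_splits[OF that(1)] that(2) by blast
  then show ?thesis
    using assms unfolding urat_rat_def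
    by (intro disjunction_in_MTL_plus) (auto simp del: splits.simps intro!: MTL_plus.intros)
qed

section \<open>Replacing subformulas by equivalent ones, and the induction over formulas\<close>

lemma equivalent_refl: "equivalent \<phi> \<phi>"
  by (simp add: equivalent_def)

lemma equivalent_URat_cong:
  assumes "equivalent \<phi> \<phi>'" "equivalent \<chi> \<chi>'" "\<forall>\<psi> \<in> atoms r. equivalent \<psi> (f \<psi>)"
  shows "equivalent (URat \<phi> I r \<chi>) (URat \<phi>' I (map_rexp f r) \<chi>')"
  unfolding equivalent_def
proof (intro allI impI)
  fix \<rho> :: "'a tword" and i
  assume \<rho>: "timed_word \<rho>"
  have "[Suc i..<j] \<in> matches (sat \<rho>) r \<longleftrightarrow> [Suc i..<j] \<in> matches (sat \<rho>) (map_rexp f r)"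
    if "j < length \<rho>" for j
    unfolding matches_map_rexp
    by (rule matches_cong) (use assms(3) \<rho> that in \<open>auto simp: equivalent_def\<close>)
  moreover have "sat \<rho> j \<phi> \<longleftrightarrow> sat \<rho> j \<phi>'" "sat \<rho> j \<chi> \<longleftrightarrow> sat \<rho> j \<chi>'" if "j < length \<rho>" for j
    using assms(1,2) \<rho> that by (auto simp: equivalent_def)
  ultimately show "sat \<rho> i (URat \<phi> I r \<chi>) \<longleftrightarrow> sat \<rho> i (URat \<phi>' I (map_rexp f r) \<chi>')"
    unfolding sat_URat
    by (smt (verit, best) greaterThanLessThan_iff less_trans)
qed

lemma equivalent_Until_cong:
  assumes "equivalent \<phi> \<phi>'" "equivalent \<chi> \<chi>'"
  shows "equivalent (Until \<phi> I \<chi>) (Until \<phi>' I \<chi>')"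
  using assms unfolding equivalent_def sat.simps by (smt (verit, best) less_trans)

text \<open>Works from the inside out: the arguments are translated first, then
  \<open>urat_rat\<close> removes the outermost modality.\<close>

lemma URAT_subset_RAT:
  assumes "\<phi> \<in> MTL_plus URAT"
  shows "\<exists>\<psi> \<in> MTL_plus RAT. equivalent \<phi> \<psi>"
  using assms
proof (induction rule: MTL_plus.induct)
  case (3 \<phi> \<psi>)
  then obtain \<phi>' \<psi>' where "\<phi>' \<in> MTL_plus RAT" "\<psi>' \<in> MTL_plus RAT" "equivalent \<phi> \<phi>'" "equivalent \<psi> \<psi>'"
    by blast
  then show ?case
    by (intro bexI[of _ "And \<phi>' \<psi>'"] MTL_plus.intros) (auto simp: equivalent_def)
next
  case (4 \<phi>)
  then obtain \<phi>' where "\<phi>' \<in> MTL_plus RAT" "equivalent \<phi> \<phi>'"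
    by blast
  then show ?case
    by (intro bexI[of _ "Neg \<phi>'"] MTL_plus.intros) (auto simp: equivalent_def)
next
  case (5 \<phi> \<chi> I)
  then show ?case
    by (meson equivalent_Until_cong MTL_plus.intros(5))
next
  case (6 \<phi> \<chi> re I)
  then obtain \<phi>' \<chi>' where *: "\<phi>' \<in> MTL_plus RAT" "\<chi>' \<in> MTL_plus RAT" "equivalent \<phi> \<phi>'" "equivalent \<chi> \<chi>'"
    by blast
  \<comment> \<open>The atoms are translated one by one; \<open>f\<close> collects the chosen
    translations for \<open>map_rexp\<close>.\<close>
  from 6 have "\<forall>\<psi> \<in> atoms re. \<exists>\<psi>'. \<psi>' \<in> MTL_plus RAT \<and> equivalent \<psi> \<psi>'"
    by blast
  then obtain f where f: "\<forall>\<psi> \<in> atoms re. f \<psi> \<in> MTL_plus RAT \<and> equivalent \<psi> (f \<psi>)"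
    by metis
  have "urat_rat \<phi>' I (map_rexp f re) \<chi>' \<in> MTL_plus RAT"
    using * f by (intro urat_rat_in_MTL_plus) (auto simp: rexp.set_map)
  moreover have "equivalent (URat \<phi> I re \<chi>) (urat_rat \<phi>' I (map_rexp f re) \<chi>')"
    using equivalent_URat_cong[OF *(3,4), of re f I] f
    by (auto simp: equivalent_def sat_urat_rat simp del: sat.simps)
  ultimately show ?case by blast
\<comment> \<open>\<open>Prop\<close> and \<open>Tru\<close> translate to themselves; the other
  modalities are excluded by their premise on \<open>op\<close>.\<close>
qed (auto intro: equivalent_refl MTL_plus.intros)

section \<open>From \<open>UM\<close> to \<open>MC\<close>\<close>

text \<open>\<open>c\<close> is the guessed residue of the number of \<open>\<psi>\<close>-positions
  from the witness \<open>j\<close> to the end. \<open>MC\<close> at \<open>i\<close> also counts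
  \<open>i\<close> itself, hence the \<open>Suc\<close> when \<open>\<psi>\<close> holds
  there.\<close>

definition um_mc ::
  "'p formula \<Rightarrow> interval \<Rightarrow> 'p formula \<Rightarrow> nat \<Rightarrow> nat \<Rightarrow> 'p formula \<Rightarrow> 'p formula" where
  "um_mc \<phi> I \<psi> k n \<chi> =
    disjunction (map (\<lambda>c. And
        (disjunction [And \<psi> (MC (ClosedInf 0) (Suc (k + c)) n \<psi>), And (Neg \<psi>) (MC (ClosedInf 0) (k + c) n \<psi>)])
        (Until \<phi> I (And \<chi> (MC (ClosedInf 0) c n \<psi>))))
      [0..<n])"

lemma card_sat_split:
  fixes i j m :: nat
  assumes "i < j" "j < m"
  shows "card {l \<in> {i..<m}. Q l} =
    (if Q i then 1 else 0) + card {l. i < l \<and> l < j \<and> Q l} + card {l \<in> {j..<m}. Q l}"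
proof -
  let ?A = "{l. l = i \<and> Q l}" and ?B = "{l. i < l \<and> l < j \<and> Q l}" and ?C = "{l \<in> {j..<m}. Q l}"
  have "{l \<in> {i..<m}. Q l} = (?A \<union> ?B) \<union> ?C"
    using assms by auto
  moreover have "card ((?A \<union> ?B) \<union> ?C) = card (?A \<union> ?B) + card ?C"
    by (rule card_Un_disjoint) (use assms in auto)
  moreover have "card (?A \<union> ?B) = card ?A + card ?B"
    by (rule card_Un_disjoint) auto
  moreover have "card ?A = (if Q i then 1 else 0)"
    by (simp add: Collect_conv_if)
  ultimately show ?thesis by simp
qed

lemma sat_um_mc:
  assumes "timed_word \<rho>" "0 < n"
  shows "sat \<rho> i (um_mc \<phi> I \<psi> k n \<chi>) \<longleftrightarrow> sat \<rho> i (UM \<phi> I \<psi> k n \<chi>)"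
proof -
  define N where "N i = card {l \<in> {i..<length \<rho>}. sat \<rho> l \<psi>}" for i
  define M where "M j = card {l. i < l \<and> l < j \<and> sat \<rho> l \<psi>}" for j
  define d :: nat where "d = (if sat \<rho> i \<psi> then 1 else 0)"
  have MC: "sat \<rho> j (MC (ClosedInf 0) c n \<psi>) \<longleftrightarrow> [N j = c] (mod n)" for j c
    by (simp add: N_def set_window_ClosedInf_0[OF assms(1)])
  have here: "sat \<rho> i (disjunction [And \<psi> (MC (ClosedInf 0) (Suc (k + c)) n \<psi>),
      And (Neg \<psi>) (MC (ClosedInf 0) (k + c) n \<psi>)]) \<longleftrightarrow> [N i = d + (k + c)] (mod n)" for c
    by (simp add: sat_disjunction MC d_def del: sat.simps(9))
  have count: "(\<exists>c<n. [N i = d + (k + c)] (mod n) \<and> [N j = c] (mod n)) \<longleftrightarrow> [M j = k] (mod n)"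
    if "i < j" "j < length \<rho>" for j
  proof -
    have N: "N i = d + (M j + N j)"
      using card_sat_split[OF that, of "\<lambda>l. sat \<rho> l \<psi>"] by (simp add: N_def M_def d_def)
    \<comment> \<open>Cancelling \<open>d\<close> and the count from \<open>j\<close> on leaves the
      count in between.\<close>
    have "[N i = d + (k + c)] (mod n) \<longleftrightarrow> [M j = k] (mod n)" if "[N j = c] (mod n)" for c
      using that unfolding N cong_add_lcancel_nat
      by (metis cong_add_rcancel_nat cong_add_lcancel_nat cong_sym cong_trans)
    \<comment> \<open>The witness for \<open>c\<close>; \<open>0 < n\<close> makes it an index of
      the disjunction.\<close>
    moreover have "[N j = N j mod n] (mod n)" "N j mod n < n"
      using assms(2) by (auto simp: cong_def)
    ultimately show ?thesis by blast
  qed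
  \<comment> \<open>\<open>G\<close> gathers what \<open>Until\<close> demands of \<open>j\<close>
    independently of \<open>c\<close>, so that the choices of \<open>c\<close> and \<open>j\<close>
    can be exchanged.\<close>
  define G where "G j \<longleftrightarrow> j < length \<rho> \<and> i < j \<and> sat \<rho> j \<chi> \<and> snd (\<rho> ! j) - snd (\<rho> ! i) \<in> points I \<and>
    (\<forall>l. i < l \<and> l < j \<longrightarrow> sat \<rho> l \<phi>)" for j
  have "sat \<rho> i (Until \<phi> I (And \<chi> (MC (ClosedInf 0) c n \<psi>))) \<longleftrightarrow> (\<exists>j. G j \<and> [N j = c] (mod n))" for c
    unfolding sat.simps(3,5) MC G_def by blast
  then have "sat \<rho> i (um_mc \<phi> I \<psi> k n \<chi>) \<longleftrightarrow>
      (\<exists>c<n. [N i = d + (k + c)] (mod n) \<and> (\<exists>j. G j \<and> [N j = c] (mod n)))"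
    unfolding um_mc_def sat_disjunction[of _ _ "map _ _"]
    by (simp only: set_map set_upt bex_simps sat.simps(3) here) auto
  also have "\<dots> \<longleftrightarrow> (\<exists>j. G j \<and> (\<exists>c<n. [N i = d + (k + c)] (mod n) \<and> [N j = c] (mod n)))"
    by blast
  also have "\<dots> \<longleftrightarrow> (\<exists>j. G j \<and> [M j = k] (mod n))"
    using count by (metis G_def)
  also have "\<dots> \<longleftrightarrow> sat \<rho> i (UM \<phi> I \<psi> k n \<chi>)"
    unfolding sat.simps G_def M_def by blast
  finally show ?thesis .
qed

lemma um_mc_in_MTL_plus:
  assumes "\<phi> \<in> MTL_plus MCOUNT" "\<psi> \<in> MTL_plus MCOUNT" "\<chi> \<in> MTL_plus MCOUNT" "0 < n"
  shows "um_mc \<phi> I \<psi> k n \<chi> \<in> MTL_plus MCOUNT"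
  using assms unfolding um_mc_def
  by (intro disjunction_in_MTL_plus) (auto intro!: MTL_plus.intros disjunction_in_MTL_plus)

lemma equivalent_UM_cong:
  assumes "equivalent \<phi> \<phi>'" "equivalent \<psi> \<psi>'" "equivalent \<chi> \<chi>'"
  shows "equivalent (UM \<phi> I \<psi> k n \<chi>) (UM \<phi>' I \<psi>' k n \<chi>')"
  unfolding equivalent_def
proof (intro allI impI)
  fix \<rho> :: "'a tword" and i
  assume \<rho>: "timed_word \<rho>"
  have eq: "sat \<rho> j \<phi> \<longleftrightarrow> sat \<rho> j \<phi>'" "sat \<rho> j \<psi> \<longleftrightarrow> sat \<rho> j \<psi>'" "sat \<rho> j \<chi> \<longleftrightarrow> sat \<rho> j \<chi>'"
    if "j < length \<rho>" for j
    using assms \<rho> that by (auto simp: equivalent_def)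
  have "{l. i < l \<and> l < j \<and> sat \<rho> l \<psi>} = {l. i < l \<and> l < j \<and> sat \<rho> l \<psi>'}" if "j < length \<rho>" for j
    using eq(2) that by (auto dest: less_trans)
  with eq(1,3) show "sat \<rho> i (UM \<phi> I \<psi> k n \<chi>) \<longleftrightarrow> sat \<rho> i (UM \<phi>' I \<psi>' k n \<chi>')"
    unfolding sat.simps by (smt (verit, best) less_trans)
qed

lemma UMOD_subset_MCOUNT:
  assumes "\<phi> \<in> MTL_plus UMOD"
  shows "\<exists>\<psi> \<in> MTL_plus MCOUNT. equivalent \<phi> \<psi>"
  using assms
proof (induction rule: MTL_plus.induct)
  case (3 \<phi> \<psi>)
  then obtain \<phi>' \<psi>' where "\<phi>' \<in> MTL_plus MCOUNT" "\<psi>' \<in> MTL_plus MCOUNT" "equivalent \<phi> \<phi>'" "equivalent \<psi> \<psi>'"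
    by blast
  then show ?case
    by (intro bexI[of _ "And \<phi>' \<psi>'"] MTL_plus.intros) (auto simp: equivalent_def)
next
  case (4 \<phi>)
  then obtain \<phi>' where "\<phi>' \<in> MTL_plus MCOUNT" "equivalent \<phi> \<phi>'"
    by blast
  then show ?case
    by (intro bexI[of _ "Neg \<phi>'"] MTL_plus.intros) (auto simp: equivalent_def)
next
  case (5 \<phi> \<chi> I)
  then show ?case
    by (meson equivalent_Until_cong MTL_plus.intros(5))
next
  case (8 n \<phi> \<chi> \<psi> I k)
  then obtain \<phi>' \<chi>' \<psi>' where *: "\<phi>' \<in> MTL_plus MCOUNT" "\<psi>' \<in> MTL_plus MCOUNT" "\<chi>' \<in> MTL_plus MCOUNT"
    "equivalent \<phi> \<phi>'" "equivalent \<psi> \<psi>'" "equivalent \<chi> \<chi>'"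
    by blast
  \<comment> \<open>The formation rule of \<open>UM\<close> provides \<open>0 < n\<close>, which
    \<open>um_mc\<close> needs for its residues.\<close>
  have "equivalent (UM \<phi> I \<psi> k n \<chi>) (um_mc \<phi>' I \<psi>' k n \<chi>')"
    using equivalent_UM_cong[OF *(4-6), of I k n] 8(2)
    by (auto simp: equivalent_def sat_um_mc simp del: sat.simps)
  with um_mc_in_MTL_plus[OF *(1-3) 8(2)] show ?case by blast
qed (auto intro: equivalent_refl MTL_plus.intros)

theorem theorem3:
  shows "(\<forall>\<phi> \<in> (MTL_plus URAT :: 'p::finite formula set). \<exists>\<psi> \<in> MTL_plus RAT. equivalent \<phi> \<psi>) \<and>
    (\<forall>\<phi> \<in> (MTL_plus UMOD :: 'p::finite formula set). \<exists>\<psi> \<in> MTL_plus MCOUNT. equivalent \<phi> \<psi>)"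
  using URAT_subset_RAT UMOD_subset_MCOUNT by blast

end
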